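(* For the distribution $\mathcal D=\operatorname{span}\{X,Y\}$ on $AdS$ there are horizontal geodesics $c(s)$ (corresponding to vanishing Lagrange multiplier $\lambda\equiv0$) with the following properties: 1. the coordinates $\alpha=\langle\dot c,T\rangle=0$, $\beta=\langle\dot c,X\rangle$, and $\gamma=\langle\dot c,Y\rangle$ are constant along the geodesic; 2. the length $|\dot c|$ is constant along the geodesic; 3. the angles between the velocity vector $\dot c$ and the horizontal frame $X,Y$ are constant along the geodesic.
   Context: $\mathbb R^{2,2}$ is $\mathbb R^4$ with $\langle x,y\rangle=-x_1y_1-x_2y_2+x_3y_3+x_4y_4$, and $AdS=\{x\in\mathbb R^4:\langle x,x\rangle=-1\}$. The vector fields $T(x)=(-x_2,x_1,x_4,-x_3)$, $X(x)=(x_3,x_4,x_1,x_2)$, $Y(x)=(x_4,-x_3,-x_2,x_1)$ form an orthogonal basis of each tangent space of $AdS$ with $\langle T,T\rangle=-1$, $\langle X,X\rangle=\langle Y,Y\rangle=1$. A curve $c$ in $AdS$ is horizontal with respect to $\mathcal D=\operatorname{span}\{X,Y\}$ if $\dot c\in\operatorname{span}\{X,Y\}$, equivalently $\langle\dot c,T\rangle=0$. On $\mathcal D$ the form $\langle\cdot,\cdot\rangle$ is positive definite; $|\cdot|$ and angles between vectors of $\mathcal D$ are taken with respect to it. For a curve $c$ in $AdS$ put $\alpha=\langle\dot c,T(c)\rangle$, $\beta=\langle\dot c,X(c)\rangle$, $\gamma=\langle\dot c,Y(c)\rangle$. A geodesic here means a smooth, non-constant horizontal curve on $AdS$ which, for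 some function $\lambda(s)$ (the Lagrange multiplier), satisfies the Euler–Lagrange equations $\frac{d}{ds}\frac{\partial L}{\partial\dot c}=\frac{\partial L}{\partial c}$ on $AdS$ of the Lagrangian $L(c,\dot c)=\tfrac12(\beta^2+\gamma^2)+\lambda(s)\alpha$, i.e. an extremal of the action $\tfrac12\int_0^1(\beta^2+\gamma^2)\,ds$ under the constraint $\alpha=0$. *)

theory Defs
  imports "HOL-Analysis.Analysis"
begin

definition ip22 :: "real^4 \<Rightarrow> real^4 \<Rightarrow> real" where
  "ip22 x y = - (x$1 * y$1) - x$2 * y$2 + x$3 * y$3 + x$4 * y$4"

definition AdS :: "(real^4) set" where
  "AdS = {x. ip22 x x = -1}"

definition AdS_tangent :: "real^4 \<Rightarrow> (real^4) set" where
  "AdS_tangent x = {w. ip22 x w = 0}"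

definition ads_T :: "real^4 \<Rightarrow> real^4" where
  "ads_T x = vector [- x$2, x$1, x$4, - x$3]"

definition ads_X :: "real^4 \<Rightarrow> real^4" where
  "ads_X x = vector [x$3, x$4, x$1, x$2]"

definition ads_Y :: "real^4 \<Rightarrow> real^4" where
  "ads_Y x = vector [x$4, - x$3, - x$2, x$1]"

definition distr_D :: "real^4 \<Rightarrow> (real^4) set" where
  "distr_D x = span {ads_X x, ads_Y x}"

text \<open>
  Length and angle for vectors of the distribution, on which the form is positive definite.
\<close>

definition hlength :: "real^4 \<Rightarrow> real" where
  "hlength v = sqrt (ip22 v v)"

definition hangle :: "real^4 \<Rightarrow> real^4 \<Rightarrow> real" where
  "hangle v w = arccos (ip22 v w / (hlength v * hlength w))"

text \<open>
  Curves are parametrised by the closed unit interval, the domain of the action integral;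
  values outside it are irrelevant, and derivatives at the end points are one-sided.
\<close>

definition smooth_curve :: "(real \<Rightarrow> real^4) \<Rightarrow> bool" where
  "smooth_curve c \<longleftrightarrow>
    (\<exists>d :: nat \<Rightarrow> real \<Rightarrow> real^4. d 0 = c \<and>
      (\<forall>n. \<forall>s\<in>{0..1}. (d n has_vector_derivative d (Suc n) s) (at s within {0..1})))"

definition velocity :: "(real \<Rightarrow> real^4) \<Rightarrow> real \<Rightarrow> real^4" where
  "velocity c s = vector_derivative c (at s within {0..1})"

definition horizontal :: "(real \<Rightarrow> real^4) \<Rightarrow> bool" where
  "horizontal c \<longleftrightarrow> (\<forall>s\<in>{0..1}. velocity c s \<in> distr_D (c s))"

definition alpha :: "(real \<Rightarrow> real^4) \<Rightarrow> real \<Rightarrow> real" where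
  "alpha c s = ip22 (velocity c s) (ads_T (c s))"

definition beta :: "(real \<Rightarrow> real^4) \<Rightarrow> real \<Rightarrow> real" where
  "beta c s = ip22 (velocity c s) (ads_X (c s))"

definition gamma :: "(real \<Rightarrow> real^4) \<Rightarrow> real \<Rightarrow> real" where
  "gamma c s = ip22 (velocity c s) (ads_Y (c s))"

definition lagrangian :: "real \<Rightarrow> real^4 \<Rightarrow> real^4 \<Rightarrow> real" where
  "lagrangian l x v =
     ((ip22 v (ads_X x))\<^sup>2 + (ip22 v (ads_Y x))\<^sup>2) / 2 + l * ip22 v (ads_T x)"

text \<open>
  The Euler--Lagrange equations on the hypersurface AdS: \<open>p\<close> and \<open>f\<close> are the (Euclidean) coordinate
  gradients of the Lagrangian in the velocity and in the position, and \<open>p' - f\<close> has to vanish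
  as a covector on the tangent space of AdS. Since admissible variations stay in AdS, only tangent
  directions are tested; equivalently, \<open>p' - f\<close> is a multiple of the differential of the
  constraint function \<open>\<lambda>x. ip22 x x\<close>.
\<close>

definition euler_lagrange_on_AdS :: "(real \<Rightarrow> real) \<Rightarrow> (real \<Rightarrow> real^4) \<Rightarrow> bool" where
  "euler_lagrange_on_AdS l c \<longleftrightarrow>
    (\<exists>p p' f :: real \<Rightarrow> real^4. \<forall>s\<in>{0..1}.
      GDERIV (\<lambda>v. lagrangian (l s) (c s) v) (velocity c s) :> p s \<and>
      GDERIV (\<lambda>x. lagrangian (l s) x (velocity c s)) (c s) :> f s \<and>
      (p has_vector_derivative p' s) (at s within {0..1}) \<and>
      (\<forall>w\<in>AdS_tangent (c s). (p' s - f s) \<bullet> w = 0))"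

definition geodesic_with_multiplier :: "(real \<Rightarrow> real) \<Rightarrow> (real \<Rightarrow> real^4) \<Rightarrow> bool" where
  "geodesic_with_multiplier l c \<longleftrightarrow>
     smooth_curve c \<and> (\<forall>s\<in>{0..1}. c s \<in> AdS) \<and> \<not> c constant_on {0..1} \<and>
     horizontal c \<and> euler_lagrange_on_AdS l c"

end

(* Each of the forms <v, T w>, <v, X w>, <v, Y w> is skew in v and w, and X^2 = Y^2 = 1, XY = T = -YX.
   For lambda = 0 the momentum p = dL/dv is therefore w -> beta <w, X c> + gamma <w, Y c>, and
   beta = p(X c), gamma = p(Y c). As X c and Y c are tangent to AdS, the Euler-Lagrange equations
   can be tested on them; they give beta' = -2 alpha gamma and gamma' = 2 alpha beta, which vanish
   for a horizontal curve. All claims follow, because X c, Y c are orthonormal.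
   The hyperbola cosh s e1 + sinh s e3, an integral curve of X, is such a geodesic. *)

theory Submission
  imports Defs
begin

section \<open>Algebra of the frame fields\<close>

lemma ads_X_nth [simp]:
  "ads_X x $ 1 = x $ 3" "ads_X x $ 2 = x $ 4" "ads_X x $ 3 = x $ 1" "ads_X x $ 4 = x $ 2"
  by (simp_all add: ads_X_def vector_def)

lemma ads_Y_nth [simp]:
  "ads_Y x $ 1 = x $ 4" "ads_Y x $ 2 = - x $ 3" "ads_Y x $ 3 = - x $ 2" "ads_Y x $ 4 = x $ 1"
  by (simp_all add: ads_Y_def vector_def)

lemma ads_T_nth [simp]:
  "ads_T x $ 1 = - x $ 2" "ads_T x $ 2 = x $ 1" "ads_T x $ 3 = x $ 4" "ads_T x $ 4 = - x $ 3"
  by (simp_all add: ads_T_def vector_def)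

lemma bounded_bilinear_ip22: "bounded_bilinear ip22"
  unfolding bilinear_conv_bounded_bilinear [symmetric] bilinear_def
  by (auto intro!: linearI simp: ip22_def algebra_simps)

lemma bounded_linear_ads_X: "bounded_linear ads_X"
  unfolding linear_conv_bounded_linear [symmetric]
  by (auto intro!: linearI simp: vec_eq_iff forall_4)

lemma bounded_linear_ads_Y: "bounded_linear ads_Y"
  unfolding linear_conv_bounded_linear [symmetric]
  by (auto intro!: linearI simp: vec_eq_iff forall_4)

text \<open>These are polynomial identities on all of R^4; the squared lengths
  \<open>- ip22 x x\<close> become 1 exactly on \<open>AdS\<close>.\<close>

lemma ip22_frame:
  "ip22 x (ads_T x) = 0" "ip22 x (ads_X x) = 0" "ip22 x (ads_Y x) = 0"
  "ip22 (ads_X x) (ads_T x) = 0" "ip22 (ads_Y x) (ads_T x) = 0"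
  "ip22 (ads_X x) (ads_Y x) = 0" "ip22 (ads_Y x) (ads_X x) = 0"
  "ip22 (ads_X x) (ads_X x) = - ip22 x x" "ip22 (ads_Y x) (ads_Y x) = - ip22 x x"
  by (simp_all add: ip22_def algebra_simps)

text \<open>Split-quaternion relations of the linear maps, kept inside the form so that they can
  rewrite the terms produced by \<open>ip22_skew\<close>.\<close>

lemma ip22_quaternion:
  "ip22 v (ads_X (ads_X w)) = ip22 v w"
  "ip22 v (ads_Y (ads_Y w)) = ip22 v w"
  "ip22 v (ads_Y (ads_X w)) = - ip22 v (ads_T w)"
  "ip22 v (ads_X (ads_Y w)) = ip22 v (ads_T w)"
  by (simp_all add: ip22_def algebra_simps)

lemma ip22_skew:
  "ip22 (ads_X v) w = - ip22 v (ads_X w)"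
  "ip22 (ads_Y v) w = - ip22 v (ads_Y w)"
  by (simp_all add: ip22_def algebra_simps)

lemma ip22_linear:
  "ip22 (v + w) u = ip22 v u + ip22 w u" "ip22 (a *\<^sub>R v) u = a * ip22 v u"
  "ip22 u (v + w) = ip22 u v + ip22 u w" "ip22 u (a *\<^sub>R v) = a * ip22 u v"
  by (simp_all add: ip22_def algebra_simps)

section \<open>Gradients of the Lagrangian with zero multiplier\<close>

lemma GDERIV_unique_inner:
  assumes "GDERIV f x :> d" and "(f has_derivative F) (at x)"
  shows "d \<bullet> h = F h"
  using has_derivative_unique [OF assms(1) [unfolded gderiv_def] assms(2)]
  by (metis inner_commute)

text \<open>With zero multiplier the Lagrangian has this shape both as a function of the velocity
  and as a function of the position.\<close>

lemma half_sum_squares_has_derivative: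
  fixes f g :: "'a::real_normed_vector \<Rightarrow> real"
  assumes "(f has_derivative f') (at x)" "(g has_derivative g') (at x)"
  shows "((\<lambda>x. ((f x)\<^sup>2 + (g x)\<^sup>2) / 2) has_derivative (\<lambda>h. f x * f' h + g x * g' h)) (at x)"
  using assms by (auto intro!: derivative_eq_intros simp: fun_eq_iff field_simps)

lemma lagrangian_zero_velocity_derivative:
  "((\<lambda>v. lagrangian 0 x v) has_derivative
     (\<lambda>h. ip22 v (ads_X x) * ip22 h (ads_X x) + ip22 v (ads_Y x) * ip22 h (ads_Y x))) (at v)"
proof -
  have "((\<lambda>v. ip22 v w) has_derivative (\<lambda>h. ip22 h w)) (at v)" for w
    by (intro bounded_linear_imp_has_derivative
        bounded_bilinear.bounded_linear_left [OF bounded_bilinear_ip22])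
  then have "((\<lambda>v. ((ip22 v (ads_X x))\<^sup>2 + (ip22 v (ads_Y x))\<^sup>2) / 2) has_derivative
     (\<lambda>h. ip22 v (ads_X x) * ip22 h (ads_X x) + ip22 v (ads_Y x) * ip22 h (ads_Y x))) (at v)"
    by (intro half_sum_squares_has_derivative)
  then show ?thesis
    by (simp add: lagrangian_def)
qed

text \<open>The fields are linear in the base point, so varying the position by \<open>h\<close>
  just replaces \<open>ads_X x\<close> and \<open>ads_Y x\<close> by \<open>ads_X h\<close> and
  \<open>ads_Y h\<close> in one factor.\<close>

lemma lagrangian_zero_position_derivative:
  "((\<lambda>x. lagrangian 0 x v) has_derivative
     (\<lambda>h. ip22 v (ads_X x) * ip22 v (ads_X h) + ip22 v (ads_Y x) * ip22 v (ads_Y h))) (at x)"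
proof -
  have "((\<lambda>x. ip22 v (J x)) has_derivative (\<lambda>h. ip22 v (J h))) (at x)"
    if "bounded_linear J" for J
    by (intro bounded_linear_imp_has_derivative bounded_linear_compose [OF _ that]
        bounded_bilinear.bounded_linear_right [OF bounded_bilinear_ip22])
  from this [OF bounded_linear_ads_X] this [OF bounded_linear_ads_Y]
  have "((\<lambda>x. ((ip22 v (ads_X x))\<^sup>2 + (ip22 v (ads_Y x))\<^sup>2) / 2) has_derivative
     (\<lambda>h. ip22 v (ads_X x) * ip22 v (ads_X h) + ip22 v (ads_Y x) * ip22 v (ads_Y h))) (at x)"
    by (rule half_sum_squares_has_derivative)
  then show ?thesis
    by (simp add: lagrangian_def)
qed

section \<open>Smooth horizontal curves and their frame coordinates\<close>

lemma smooth_curve_velocity: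
  assumes "smooth_curve c"
  obtains a where
    "\<And>s. s \<in> {0..1} \<Longrightarrow> (c has_vector_derivative velocity c s) (at s within {0..1})"
    "\<And>s. s \<in> {0..1} \<Longrightarrow> (velocity c has_vector_derivative a s) (at s within {0..1})"
proof -
  obtain d :: "nat \<Rightarrow> real \<Rightarrow> real^4" where d0: "d 0 = c"
    and d: "\<And>n s. s \<in> {0..1} \<Longrightarrow> (d n has_vector_derivative d (Suc n) s) (at s within {0..1})"
    using assms unfolding smooth_curve_def by blast
  \<comment> \<open>Derivatives within a nondegenerate closed interval are unique, also at the end
    points, so \<open>vector_derivative\<close> picks \<open>d 1 s\<close>.\<close>
  have v: "velocity c s = d 1 s" if "s \<in> {0..1}" for s
    unfolding velocity_def using vector_derivative_within_closed_interval [OF _ that d [OF that, of 0]]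
    by (simp add: d0)
  show ?thesis
  proof (rule that)
    show "(c has_vector_derivative velocity c s) (at s within {0..1})" if "s \<in> {0..1}" for s
      using d [OF that, of 0] v [OF that] d0 by simp
    show "(velocity c has_vector_derivative d 2 s) (at s within {0..1})" if "s \<in> {0..1}" for s
      using d [OF that, of 1] v that
      by (intro has_vector_derivative_transform [OF that, of "velocity c" "d 1"])
        (simp_all add: numeral_2_eq_2)
  qed
qed

text \<open>On \<open>AdS\<close> the pair \<open>ads_X\<close>, \<open>ads_Y\<close> is orthonormal
  and orthogonal to \<open>ads_T\<close>, so pairing with the frame reads off the coefficients in
  the span.\<close>

lemma horizontal_velocity:
  assumes "horizontal c" "s \<in> {0..1}" "c s \<in> AdS"
  shows "velocity c s = beta c s *\<^sub>R ads_X (c s) + gamma c s *\<^sub>R ads_Y (c s)" and "alpha c s = 0"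
proof -
  have "velocity c s \<in> span {ads_X (c s), ads_Y (c s)}"
    using assms(1,2) by (simp add: horizontal_def distr_D_def)
  then obtain a b where "velocity c s - a *\<^sub>R ads_X (c s) = b *\<^sub>R ads_Y (c s)"
    unfolding span_insert [of _ "{ads_Y (c s)}"] span_singleton by blast
  then have v: "velocity c s = a *\<^sub>R ads_X (c s) + b *\<^sub>R ads_Y (c s)"
    by (simp add: diff_eq_eq add.commute)
  have "ip22 (c s) (c s) = -1"
    using assms(3) by (simp add: AdS_def)
  then show "velocity c s = beta c s *\<^sub>R ads_X (c s) + gamma c s *\<^sub>R ads_Y (c s)" "alpha c s = 0"
    by (simp_all add: beta_def gamma_def alpha_def v ip22_linear ip22_frame)
qed

lemma hlength_frame_sum:
  assumes "x \<in> AdS"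
  shows "hlength (b *\<^sub>R ads_X x + g *\<^sub>R ads_Y x) = sqrt (b\<^sup>2 + g\<^sup>2)"
  using assms by (simp add: hlength_def ip22_linear ip22_frame AdS_def power2_eq_square)

lemma hlength_frame:
  assumes "x \<in> AdS"
  shows "hlength (ads_X x) = 1" "hlength (ads_Y x) = 1"
  using assms by (simp_all add: hlength_def ip22_frame AdS_def)

text \<open>The momentum paired with a frame field is differentiated by the product rule. The factor
  \<open>alpha\<close> stays in the result; horizontality enters only later.\<close>

lemma euler_lagrange_frame_derivative:
  assumes el: "euler_lagrange_on_AdS (\<lambda>_. 0) c"
    and c: "\<And>s. s \<in> {0..1} \<Longrightarrow> (c has_vector_derivative velocity c s) (at s within {0..1})"
    and AdS: "\<And>s. s \<in> {0..1} \<Longrightarrow> c s \<in> AdS"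
    and s: "s \<in> {0..1}"
  shows "(beta c has_vector_derivative - 2 * gamma c s * alpha c s) (at s within {0..1})"
    and "(gamma c has_vector_derivative 2 * beta c s * alpha c s) (at s within {0..1})"
proof -
  let ?v = "velocity c"
  obtain p p' f where pd: "\<And>s. s \<in> {0..1} \<Longrightarrow> GDERIV (\<lambda>v. lagrangian 0 (c s) v) (?v s) :> p s"
    and fd: "GDERIV (\<lambda>x. lagrangian 0 x (?v s)) (c s) :> f s"
    and p': "(p has_vector_derivative p' s) (at s within {0..1})"
    and tan: "\<And>w. w \<in> AdS_tangent (c s) \<Longrightarrow> (p' s - f s) \<bullet> w = 0"
    using el s unfolding euler_lagrange_on_AdS_def by blast
  \<comment> \<open>The gradient is known only by existence; uniqueness of derivatives determines
    its pairing with every \<open>h\<close>, so no coordinates are needed.\<close>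
  have p: "p t \<bullet> h = beta c t * ip22 h (ads_X (c t)) + gamma c t * ip22 h (ads_Y (c t))"
    if "t \<in> {0..1}" for t h
    unfolding beta_def gamma_def
    by (rule GDERIV_unique_inner [OF pd [OF that] lagrangian_zero_velocity_derivative])
  have f: "f s \<bullet> h = beta c s * ip22 (?v s) (ads_X h) + gamma c s * ip22 (?v s) (ads_Y h)" for h
    unfolding beta_def gamma_def
    by (rule GDERIV_unique_inner [OF fd lagrangian_zero_position_derivative])
  \<comment> \<open>Treats both frame fields at once: \<open>J (c s)\<close> is tangent to
    \<open>AdS\<close>, so the Euler-Lagrange equations replace \<open>p' s\<close> by
    \<open>f s\<close>.\<close>
  have deriv: "((\<lambda>t. p t \<bullet> J (c t)) has_vector_derivative f s \<bullet> J (c s) + p s \<bullet> J (?v s))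
      (at s within {0..1})"
    if J: "bounded_linear J" and J0: "ip22 (c s) (J (c s)) = 0" for J
  proof -
    have "p' s \<bullet> J (c s) = f s \<bullet> J (c s)"
      using tan [of "J (c s)"] J0 by (simp add: AdS_tangent_def inner_diff_left)
    then show ?thesis
      using bounded_bilinear.has_vector_derivative [OF bounded_bilinear_inner p'
          bounded_linear.has_vector_derivative [OF J c [OF s]]]
      by (simp add: add.commute)
  qed

  have unit: "ip22 (c t) (c t) = -1" if "t \<in> {0..1}" for t
    using AdS [OF that] by (simp add: AdS_def)
  \<comment> \<open>The terms \<open>beta c s * ip22 (?v s) (c s)\<close> cancel by skewness, while
    both mixed terms equal \<open>- gamma c s * alpha c s\<close>, since XY = -YX = T.\<close>
  have "f s \<bullet> ads_X (c s) + p s \<bullet> ads_X (?v s) = - 2 * gamma c s * alpha c s"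
    by (simp add: f p [OF s] ip22_skew ip22_quaternion alpha_def)
  with deriv [OF bounded_linear_ads_X]
  have "((\<lambda>t. p t \<bullet> ads_X (c t)) has_vector_derivative - 2 * gamma c s * alpha c s)
      (at s within {0..1})"
    by (simp add: ip22_frame)
  \<comment> \<open>Orthonormality turns \<open>p t \<bullet> ads_X (c t)\<close> into
    \<open>beta c t\<close>, but only for \<open>t\<close> in the interval, hence the transfer of
    the derivative.\<close>
  then show "(beta c has_vector_derivative - 2 * gamma c s * alpha c s) (at s within {0..1})"
    by (rule has_vector_derivative_transform [OF s, rotated]) (simp add: p ip22_frame unit)
  have "f s \<bullet> ads_Y (c s) + p s \<bullet> ads_Y (?v s) = 2 * beta c s * alpha c s"
    by (simp add: f p [OF s] ip22_skew ip22_quaternion alpha_def)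
  with deriv [OF bounded_linear_ads_Y]
  have "((\<lambda>t. p t \<bullet> ads_Y (c t)) has_vector_derivative 2 * beta c s * alpha c s)
      (at s within {0..1})"
    by (simp add: ip22_frame)
  then show "(gamma c has_vector_derivative 2 * beta c s * alpha c s) (at s within {0..1})"
    by (rule has_vector_derivative_transform [OF s, rotated]) (simp add: p ip22_frame unit)
qed

lemma geodesic_zero_multiplier_constants:
  assumes geo: "geodesic_with_multiplier (\<lambda>_. 0) c"
  obtains b g where
    "\<And>s. s \<in> {0..1} \<Longrightarrow> c s \<in> AdS" "\<And>s. s \<in> {0..1} \<Longrightarrow> alpha c s = 0"
    "\<And>s. s \<in> {0..1} \<Longrightarrow> beta c s = b" "\<And>s. s \<in> {0..1} \<Longrightarrow> gamma c s = g"
    "\<And>s. s \<in> {0..1} \<Longrightarrow> velocity c s = b *\<^sub>R ads_X (c s) + g *\<^sub>R ads_Y (c s)"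
    "b\<^sup>2 + g\<^sup>2 \<noteq> 0"
proof -
  from geo have smooth: "smooth_curve c" and AdS: "\<And>s. s \<in> {0..1} \<Longrightarrow> c s \<in> AdS"
    and nonconst: "\<not> c constant_on {0..1}" and hor: "horizontal c"
    and el: "euler_lagrange_on_AdS (\<lambda>_. 0) c"
    by (auto simp: geodesic_with_multiplier_def)
  have c: "(c has_vector_derivative velocity c s) (at s within {0..1})" if "s \<in> {0..1}" for s
    using smooth_curve_velocity [OF smooth] that by blast
  note v = horizontal_velocity [OF hor _ AdS]
  have "(beta c has_vector_derivative 0) (at s within {0..1})"
    and "(gamma c has_vector_derivative 0) (at s within {0..1})" if "s \<in> {0..1}" for s
    using euler_lagrange_frame_derivative [OF el c AdS that] v(2) [OF that that] by simp_all
  then obtain b g where b: "\<And>s. s \<in> {0..1} \<Longrightarrow> beta c s = b"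
    and g: "\<And>s. s \<in> {0..1} \<Longrightarrow> gamma c s = g"
    by (metis has_vector_derivative_zero_constant convex_real_interval(5))
  have vel: "velocity c s = b *\<^sub>R ads_X (c s) + g *\<^sub>R ads_Y (c s)" if "s \<in> {0..1}" for s
    using v(1) [OF that that] b g that by simp
  have "b\<^sup>2 + g\<^sup>2 \<noteq> 0"
  \<comment> \<open>If both constants vanished, so would the velocity, and the curve would be
    constant.\<close>
  proof
    assume "b\<^sup>2 + g\<^sup>2 = 0"
    then have "b = 0" "g = 0"
      by (simp_all add: sum_power2_eq_zero_iff)
    then have "(c has_vector_derivative 0) (at s within {0..1})" if "s \<in> {0..1}" for s
      using c [OF that] vel [OF that] by simp
    then show False
      using has_vector_derivative_zero_constant [OF convex_real_interval(5), of 0 1 c] nonconst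
      unfolding constant_on_def by metis
  qed
  with that AdS v(2) b g vel show thesis
    by blast
qed

section \<open>The hyperbola as an example of a geodesic\<close>

lemma has_vector_derivative_cosh_sinh:
  fixes u w :: "'a :: real_normed_vector"
  shows "((\<lambda>s. cosh s *\<^sub>R u + sinh s *\<^sub>R w) has_vector_derivative
    sinh s *\<^sub>R u + cosh s *\<^sub>R w) (at s within S)"
  by (auto intro!: derivative_eq_intros simp: has_vector_derivative_def fun_eq_iff algebra_simps)

definition hyperbola :: "real \<Rightarrow> real^4" where
  "hyperbola s = cosh s *\<^sub>R axis 1 1 + sinh s *\<^sub>R axis 3 1"

definition hyperbola' :: "real \<Rightarrow> real^4" where
  "hyperbola' s = sinh s *\<^sub>R axis 1 1 + cosh s *\<^sub>R axis 3 1"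

lemma hyperbola_deriv:
  "(hyperbola has_vector_derivative hyperbola' s) (at s within S)"
  "(hyperbola' has_vector_derivative hyperbola s) (at s within S)"
  using has_vector_derivative_cosh_sinh [of "axis 1 1 :: real^4" "axis 3 1"]
    has_vector_derivative_cosh_sinh [of "axis 3 1 :: real^4" "axis 1 1"]
  by (simp_all add: hyperbola_def [abs_def] hyperbola'_def [abs_def] add.commute)

lemma hyperbola_nth [simp]:
  "hyperbola s $ 1 = cosh s" "hyperbola s $ 2 = 0" "hyperbola s $ 3 = sinh s" "hyperbola s $ 4 = 0"
  "hyperbola' s $ 1 = sinh s" "hyperbola' s $ 2 = 0" "hyperbola' s $ 3 = cosh s" "hyperbola' s $ 4 = 0"
  by (simp_all add: hyperbola_def hyperbola'_def axis_def)

lemma velocity_hyperbola: "s \<in> {0..1} \<Longrightarrow> velocity hyperbola s = hyperbola' s"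
  unfolding velocity_def
  by (rule vector_derivative_within_closed_interval) (auto intro: hyperbola_deriv)

text \<open>The integral-curve equation: it gives horizontality, with frame coordinates
  \<open>beta\<close> = 1 and \<open>gamma\<close> = 0.\<close>

lemma hyperbola'_eq: "hyperbola' s = ads_X (hyperbola s)"
  by (simp add: vec_eq_iff forall_4)

lemma geodesic_hyperbola: "geodesic_with_multiplier (\<lambda>_. 0) hyperbola"
  unfolding geodesic_with_multiplier_def
proof (intro conjI ballI notI)
  show "smooth_curve hyperbola"
    \<comment> \<open>The second derivative is the curve itself, so the derivatives alternate with
      period two.\<close>
    unfolding smooth_curve_def
    by (rule exI [of _ "\<lambda>n. if even n then hyperbola else hyperbola'"])
      (simp add: hyperbola_deriv)
  show "hyperbola s \<in> AdS" for s
    using hyperbolic_pythagoras [of s]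
    by (simp add: AdS_def ip22_def power2_eq_square)
  show False if "hyperbola constant_on {0..1}"
  proof -
    have "hyperbola 0 = hyperbola 1"
      using that unfolding constant_on_def by force
    then have "sinh 0 = sinh (1::real)"
      by (metis hyperbola_nth(3))
    then show False
      by simp
  qed
  show "horizontal hyperbola"
    by (auto simp: horizontal_def distr_D_def velocity_hyperbola hyperbola'_eq intro: span_base)
  \<comment> \<open>Since \<open>beta\<close> = 1 and \<open>gamma\<close> = 0, the momentum is the
    form paired with \<open>ads_X (hyperbola s)\<close>; lowering the index flips the sign of the
    first coordinate. The ordering of the summands fits
    \<open>has_vector_derivative_cosh_sinh\<close>.\<close>
  let ?p = "\<lambda>s. cosh s *\<^sub>R axis 3 1 + sinh s *\<^sub>R - axis 1 1 :: real^4"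
  let ?p' = "\<lambda>s. sinh s *\<^sub>R axis 3 1 + cosh s *\<^sub>R - axis 1 1 :: real^4"
  have unit: "cosh s * cosh s - sinh s * sinh s = 1" for s :: real
    using hyperbolic_pythagoras [of s] by (simp add: power2_eq_square)
  show "euler_lagrange_on_AdS (\<lambda>_. 0) hyperbola"
    unfolding euler_lagrange_on_AdS_def
  proof (rule exI [of _ ?p], rule exI [of _ ?p'], rule exI [of _ "\<lambda>s. - ?p' s"],
      intro ballI conjI)
    fix s :: real
    assume s: "s \<in> {0..1}"
    show "GDERIV (\<lambda>v. lagrangian 0 (hyperbola s) v) (velocity hyperbola s) :> ?p s"
      unfolding gderiv_def
      by (rule has_derivative_eq_rhs [OF lagrangian_zero_velocity_derivative])
        (simp add: fun_eq_iff velocity_hyperbola [OF s] ip22_def inner_vec_def sum_4 axis_def unit)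
    show "GDERIV (\<lambda>x. lagrangian 0 x (velocity hyperbola s)) (hyperbola s) :> - ?p' s"
      unfolding gderiv_def
      by (rule has_derivative_eq_rhs [OF lagrangian_zero_position_derivative])
        (simp add: fun_eq_iff velocity_hyperbola [OF s] ip22_def inner_vec_def sum_4 axis_def unit)
    show "(?p has_vector_derivative ?p' s) (at s within {0..1})"
      by (rule has_vector_derivative_cosh_sinh)
    \<comment> \<open>Here \<open>?p' s \<bullet> w\<close> is \<open>ip22 (hyperbola s) w\<close>:
      the residual is nonzero but normal to \<open>AdS\<close>.\<close>
    show "(?p' s - - ?p' s) \<bullet> w = 0" if "w \<in> AdS_tangent (hyperbola s)" for w
      using that by (simp add: AdS_tangent_def ip22_def inner_vec_def sum_4 axis_def)
  qed
qed

text \<open>The existence conjunct excludes vacuity, and the nonvanishing velocity makes the angles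
  genuine, as \<open>hangle\<close> divides by the length.\<close>

theorem theorem9:
  shows "(\<exists>c. geodesic_with_multiplier (\<lambda>_. 0) c) \<and>
    (\<forall>c. geodesic_with_multiplier (\<lambda>_. 0) c \<longrightarrow>
       (\<forall>s\<in>{0..1}. alpha c s = 0) \<and> beta c constant_on {0..1} \<and> gamma c constant_on {0..1} \<and>
       (\<lambda>s. hlength (velocity c s)) constant_on {0..1} \<and>
       (\<forall>s\<in>{0..1}. velocity c s \<noteq> 0) \<and>
       (\<lambda>s. hangle (velocity c s) (ads_X (c s))) constant_on {0..1} \<and>
       (\<lambda>s. hangle (velocity c s) (ads_Y (c s))) constant_on {0..1})"
proof (intro conjI allI impI)
  show "\<exists>c. geodesic_with_multiplier (\<lambda>_. 0) c"
    using geodesic_hyperbola by blast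
  fix c
  assume "geodesic_with_multiplier (\<lambda>_. 0) c"
  then obtain b g where AdS: "\<And>s. s \<in> {0..1} \<Longrightarrow> c s \<in> AdS"
    and a: "\<And>s. s \<in> {0..1} \<Longrightarrow> alpha c s = 0"
    and b: "\<And>s. s \<in> {0..1} \<Longrightarrow> beta c s = b" and g: "\<And>s. s \<in> {0..1} \<Longrightarrow> gamma c s = g"
    and v: "\<And>s. s \<in> {0..1} \<Longrightarrow> velocity c s = b *\<^sub>R ads_X (c s) + g *\<^sub>R ads_Y (c s)"
    and bg: "b\<^sup>2 + g\<^sup>2 \<noteq> 0"
    using geodesic_zero_multiplier_constants by blast
  show "\<forall>s\<in>{0..1}. alpha c s = 0" "beta c constant_on {0..1}" "gamma c constant_on {0..1}"
    using a b g by (auto simp: constant_on_def)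
  have len: "hlength (velocity c s) = sqrt (b\<^sup>2 + g\<^sup>2)" if "s \<in> {0..1}" for s
    using that by (simp add: v AdS hlength_frame_sum)
  then show "(\<lambda>s. hlength (velocity c s)) constant_on {0..1}"
    by (auto simp: constant_on_def)
  have "hlength 0 = 0"
    by (simp add: hlength_def ip22_def)
  then show "\<forall>s\<in>{0..1}. velocity c s \<noteq> 0"
    using len bg by (metis real_sqrt_eq_zero_cancel_iff)
  \<comment> \<open>The frame vectors have length 1, so the cosines are \<open>beta\<close> and
    \<open>gamma\<close> divided by the constant speed.\<close>
  have "hangle (velocity c s) (ads_X (c s)) = arccos (b / sqrt (b\<^sup>2 + g\<^sup>2))"
    and "hangle (velocity c s) (ads_Y (c s)) = arccos (g / sqrt (b\<^sup>2 + g\<^sup>2))"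
    if "s \<in> {0..1}" for s
    using b [OF that] g [OF that]
    by (simp_all add: hangle_def len [OF that] hlength_frame [OF AdS [OF that]] beta_def gamma_def)
  then show "(\<lambda>s. hangle (velocity c s) (ads_X (c s))) constant_on {0..1}"
    and "(\<lambda>s. hangle (velocity c s) (ads_Y (c s))) constant_on {0..1}"
    by (auto simp: constant_on_def)
qed

end
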